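(* Let $V$ be a real separable Hilbert space and let $a,b,m$ be symmetric bilinear forms on $V$ such that $a$ is continuous and $V$-coercive, $b$ is weakly continuous, and $m$ is weakly continuous with $m(u,u)>0$ for all nonzero $u\in V$. Then the first eigencurve $\lambda\mapsto\mu_1(\lambda)$ of $(a,b,m)$ is a concave function on $\mathbb{R}$.
   Context: "$a$ is continuous and $V$-coercive" means there are constants $0<\kappa_1\le\kappa_2<\infty$ with $\kappa_1\|u\|^2\le a(u,u)\le\kappa_2\|u\|^2$ for all $u\in V$. A symmetric bilinear form $b$ on $V$ is weakly continuous if $u_j\rightharpoonup u$ and $v_j\rightharpoonup v$ weakly in $V$ imply $b(u_j,v_j)\to b(u,v)$. For $\lambda\in\mathbb{R}$, $\mu_1(\lambda)$ is the smallest real number $\mu$ for which there is a nonzero $u\in V$ with $a(u,v)-\lambda b(u,v)=\mu\,m(u,v)$ for all $v\in V$; equivalently $\mu_1(\lambda)=\inf_{0\ne v\in V}\frac{a(v,v)-\lambda b(v,v)}{m(v,v)}$. *)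

theory Defs
  imports "HOL-Analysis.Analysis"
begin

text \<open>The Hilbert space \<open>V\<close> is the whole type \<open>'a :: {real_inner, complete_space}\<close>;
  separability is the predicate \<open>separable_space euclidean\<close>.\<close>

definition symmetric_bilinear_form :: "('a::real_vector \<Rightarrow> 'a \<Rightarrow> real) \<Rightarrow> bool" where
  "symmetric_bilinear_form b \<longleftrightarrow> bilinear b \<and> (\<forall>u v. b u v = b v u)"

definition continuous_coercive :: "('a::real_normed_vector \<Rightarrow> 'a \<Rightarrow> real) \<Rightarrow> bool" where
  "continuous_coercive a \<longleftrightarrow>
     (\<exists>\<kappa>\<^sub>1 \<kappa>\<^sub>2. 0 < \<kappa>\<^sub>1 \<and> \<kappa>\<^sub>1 \<le> \<kappa>\<^sub>2 \<and>
        (\<forall>u. \<kappa>\<^sub>1 * (norm u)\<^sup>2 \<le> a u u \<and> a u u \<le> \<kappa>\<^sub>2 * (norm u)\<^sup>2))"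

definition weakly_tendsto :: "(nat \<Rightarrow> 'a::real_normed_vector) \<Rightarrow> 'a \<Rightarrow> bool" where
  "weakly_tendsto x l \<longleftrightarrow>
     (\<forall>f :: 'a \<Rightarrow> real. bounded_linear f \<longrightarrow> (\<lambda>j. f (x j)) \<longlonglongrightarrow> f l)"

definition weakly_continuous_form :: "('a::real_normed_vector \<Rightarrow> 'a \<Rightarrow> real) \<Rightarrow> bool" where
  "weakly_continuous_form b \<longleftrightarrow>
     (\<forall>x y u v. weakly_tendsto x u \<longrightarrow> weakly_tendsto y v \<longrightarrow>
        (\<lambda>j. b (x j) (y j)) \<longlonglongrightarrow> b u v)"

definition is_eigenvalue ::
  "('a::real_vector \<Rightarrow> 'a \<Rightarrow> real) \<Rightarrow> ('a \<Rightarrow> 'a \<Rightarrow> real) \<Rightarrow> ('a \<Rightarrow> 'a \<Rightarrow> real) \<Rightarrow> real \<Rightarrow> real \<Rightarrow> bool" where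
  "is_eigenvalue a b m t \<mu> \<longleftrightarrow> (\<exists>u. u \<noteq> 0 \<and> (\<forall>v. a u v - t * b u v = \<mu> * m u v))"

text \<open>If no least eigenvalue exists, \<open>LEAST\<close> returns an unspecified real. Under the standing
  hypotheses this can only happen when \<open>V\<close> is the zero space; there the set of eigenvalues is empty
  for every \<open>t\<close>, so the value does not depend on \<open>t\<close>.\<close>

definition first_eigencurve ::
  "('a::real_vector \<Rightarrow> 'a \<Rightarrow> real) \<Rightarrow> ('a \<Rightarrow> 'a \<Rightarrow> real) \<Rightarrow> ('a \<Rightarrow> 'a \<Rightarrow> real) \<Rightarrow> real \<Rightarrow> real" where
  "first_eigencurve a b m t = (LEAST \<mu>. is_eigenvalue a b m t \<mu>)"

end

theory Submission
  imports Defs "HOL-Real_Asymp.Real_Asymp"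
begin

text \<open>
  The least eigenvalue \<open>\<mu>\<^sub>1(t)\<close> is the largest real \<open>\<nu>\<close> such that
  \<open>\<nu> m(v, v) \<le> a(v, v) - t b(v, v)\<close> for every \<open>v\<close> (\<open>le_first_eigencurve_iff\<close>). For fixed
  \<open>v\<close> this inequality is affine in \<open>(t, \<nu>)\<close>, so the region below the curve is an intersection of
  half-planes, hence convex, and the curve is concave.

  The substance is the characterisation, that is, the fact that the infimum of the Rayleigh quotient
  is finite and attained (\<open>Rayleigh_quotient_minimizer\<close>). Bounded sequences have weakly convergent
  subsequences (\<open>bounded_seq_weakly_convergent_subseq\<close>). Along such a subsequence \<open>b\<close> and \<open>m\<close>
  converge, and the weak limit of unit vectors whose quotients stay bounded above is not zero,
  because at a zero limit coercivity would be violated (\<open>low_energy_seq_nonzero_weak_limit\<close>). This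
  excludes quotients tending to minus infinity. Since \<open>a\<close> is weakly lower semicontinuous
  (\<open>weak_limit_energy_le\<close>), the weak limit of a minimizing sequence is a minimizer. At a minimizer
  \<open>u\<close> with value \<open>\<mu>\<close> the nonnegative form \<open>a - t b - \<mu> m\<close> vanishes at \<open>(u, u)\<close>, hence at
  \<open>(u, v)\<close> for all \<open>v\<close> (\<open>nonneg_form_null_vector\<close>), which is the eigenvalue equation. No
  eigenvalue is smaller, as is seen by testing its equation with its own eigenvector.
\<close>

section \<open>Weak sequential compactness in separable Hilbert spaces\<close>

text \<open>The first-order condition at a minimum: it is applied to the increment of a quadratic
  functional along a line through its minimizer.\<close>

lemma linear_coefficient_zero:
  fixes p q :: real
  assumes "\<And>s. 0 \<le> 2 * s * p + s\<^sup>2 * q"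
  shows "p = 0"
proof (rule ccontr)
  assume "p \<noteq> 0"
  define Q where "Q = \<bar>q\<bar> + 1"
  have Q: "Q > 0" "q < Q" by (auto simp: Q_def)
  \<comment> \<open>A step small enough, and against the slope, that the linear term dominates.\<close>
  have "0 \<le> 2 * (- p / Q) * p + (- p / Q)\<^sup>2 * q" by (rule assms)
  also have "\<dots> = p\<^sup>2 * (q - 2 * Q) / Q\<^sup>2"
    using Q by (simp add: field_simps power2_eq_square)
  also have "\<dots> < 0"
    using Q \<open>p \<noteq> 0\<close> by (simp add: divide_less_0_iff mult_less_0_iff)
  finally show False by simp
qed

text \<open>The representing vector minimizes \<open>J(x) = \<parallel>x\<parallel>\<^sup>2 - 2 f(x)\<close>. The parallelogram law makes every
  minimizing sequence Cauchy, and the first-order condition at the limit \<open>u\<close> reads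
  \<open>\<langle>u, v\<rangle> = f(v)\<close>.\<close>

lemma Riesz_representation:
  fixes f :: "'a::{real_inner, complete_space} \<Rightarrow> real"
  assumes f: "bounded_linear f"
  obtains u where "\<And>v. f v = inner u v"
proof -
  interpret bounded_linear f by (rule f)
  define J where "J x = (norm x)\<^sup>2 - 2 * f x" for x
  obtain K where K: "\<And>x. norm (f x) \<le> norm x * K" using bounded by blast
  have lower: "- K\<^sup>2 \<le> J x" for x
  proof -
    have "0 \<le> (norm x - K)\<^sup>2" by simp
    also have "\<dots> = (norm x)\<^sup>2 - 2 * (norm x * K) + K\<^sup>2" by (simp add: power2_eq_square algebra_simps)
    finally show ?thesis using K[of x] unfolding J_def real_norm_def by linarith
  qed
  define d where "d = (INF x. J x)"
  have bdd: "bdd_below (range J)" using lower by (auto intro!: bdd_belowI)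
  have d: "d \<le> J x" for x unfolding d_def by (rule cINF_lower[OF bdd]) simp
  have "\<exists>x. J x < d + 1 / (real n + 1)" for n :: nat
    using cINF_less_iff[OF _ bdd, of "d + 1 / (real n + 1)"] by (simp add: d_def add_pos_nonneg)
  then obtain x where x: "\<And>n. J (x n) < d + 1 / (real n + 1)" by metis
  have par: "(norm (y - z))\<^sup>2 \<le> 2 * J y + 2 * J z - 4 * d" for y z
  proof -
    \<comment> \<open>Parallelogram law: \<open>d\<close> bounds the value of \<open>J\<close> at the midpoint \<open>c\<close> from below.\<close>
    define c where "c = (1/2) *\<^sub>R (y + z)"
    have "2 * norm c = norm (y + z)" "2 * f c = f y + f z"
      by (simp_all add: c_def scaleR add del: scaleR_add_right)
    moreover have "4 * J c = (2 * norm c)\<^sup>2 - 4 * (2 * f c)"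
      by (simp add: J_def power_mult_distrib)
    ultimately have "4 * J c = (norm (y + z))\<^sup>2 - 4 * (f y + f z)" by simp
    then have "(norm (y - z))\<^sup>2 = 2 * J y + 2 * J z - 4 * J c"
      unfolding J_def
      by (simp add: power2_norm_eq_inner inner_simps inner_commute)
    then show ?thesis using d[of c] by linarith
  qed
  have "Cauchy x"
  proof (rule CauchyI)
    fix e :: real assume e: "0 < e"
    have "(\<lambda>n. 1 / (real n + 1)) \<longlonglongrightarrow> 0" by real_asymp
    then have "\<forall>\<^sub>F n in sequentially. 1 / (real n + 1) < e\<^sup>2 / 4"
      using e by (intro order_tendstoD(2)) auto
    then obtain N where N: "1 / (real N + 1) < e\<^sup>2 / 4" by (auto simp: eventually_sequentially)
    show "\<exists>M. \<forall>m\<ge>M. \<forall>n\<ge>M. norm (x m - x n) < e"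
    proof (intro exI allI impI)
      fix m n assume mn: "m \<ge> N" "n \<ge> N"
      have "1 / (real m + 1) \<le> 1 / (real N + 1)" "1 / (real n + 1) \<le> 1 / (real N + 1)"
        using mn by (auto intro!: divide_left_mono)
      then have "(norm (x m - x n))\<^sup>2 < e\<^sup>2"
        using par[of "x m" "x n"] x[of m] x[of n] N by linarith
      then show "norm (x m - x n) < e" using e by (meson less_eq_real_def power_less_imp_less_base)
    qed
  qed
  then obtain u where u: "x \<longlonglongrightarrow> u" using Cauchy_convergent_iff convergent_def by blast
  have "(\<lambda>n. J (x n)) \<longlonglongrightarrow> J u"
    unfolding J_def by (intro tendsto_intros u tendsto)
  moreover have "(\<lambda>n. d + 1 / (real n + 1)) \<longlonglongrightarrow> d" by real_asymp
  ultimately have "J u \<le> d"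
    by (rule LIMSEQ_le) (use x less_imp_le in blast)
  then have min: "J u \<le> J y" for y using d[of y] by linarith
  have "inner u v - f v = 0" for v
  proof (rule linear_coefficient_zero)
    fix s :: real
    have "(norm (u + s *\<^sub>R v))\<^sup>2 = (norm u)\<^sup>2 + 2 * s * inner u v + s\<^sup>2 * (norm v)\<^sup>2"
      unfolding power2_norm_eq_inner
      by (simp add: inner_simps inner_commute algebra_simps power2_eq_square)
    then have "J (u + s *\<^sub>R v) - J u = 2 * s * (inner u v - f v) + s\<^sup>2 * (norm v)\<^sup>2"
      by (simp add: J_def add scaleR algebra_simps)
    then show "0 \<le> 2 * s * (inner u v - f v) + s\<^sup>2 * (norm v)\<^sup>2"
      using min[of "u + s *\<^sub>R v"] by linarith
  qed
  then show thesis using that[of u] by simp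
qed

text \<open>The inner products with a dense sequence \<open>e\<close> form points of a countable product of compact
  intervals. This product is compact and metrizable, so some subsequence converges in every
  coordinate; this takes the place of a diagonal argument. Boundedness carries the convergence from
  the dense set to all vectors, and the Riesz theorem turns the limit functional into a vector.\<close>

lemma bounded_seq_weakly_convergent_subseq:
  fixes x :: "nat \<Rightarrow> 'a::{real_inner, complete_space}"
  assumes "separable_space (euclidean :: 'a topology)" and x: "\<And>n. norm (x n) \<le> C"
  obtains r l where "strict_mono r" "weakly_tendsto (x \<circ> r) l"
proof -
  obtain D :: "'a set" where D: "countable D" "closure D = UNIV"
    using assms(1) unfolding separable_space_def by auto
  then have "D \<noteq> {}" by auto
  define e where "e = from_nat_into D"
  have rng: "range e = D"
    unfolding e_def by (rule range_from_nat_into[OF \<open>D \<noteq> {}\<close> D(1)])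
  have C: "C \<ge> 0" using x[of 0] norm_ge_zero order_trans by blast
  define P :: "(nat \<Rightarrow> real) set" where "P = (\<Pi>\<^sub>E k\<in>UNIV. {- (C * norm (e k)) .. C * norm (e k)})"
  have "compactin (product_topology (\<lambda>k. euclidean) UNIV) P"
    unfolding P_def by (subst compactin_PiE) simp
  then have "compact P" by (simp add: euclidean_product_topology)
  then have "seq_compact P" by (rule compact_imp_seq_compact)
  moreover have "(\<lambda>k. inner (x n) (e k)) \<in> P" for n
  proof -
    have "\<bar>inner (x n) (e k)\<bar> \<le> C * norm (e k)" for k
      using Cauchy_Schwarz_ineq2[of "x n" "e k"] mult_right_mono[OF x[of n], of "norm (e k)"] by simp
    then show ?thesis unfolding P_def PiE_UNIV_domain Pi_iff by (simp add: abs_le_iff minus_le_iff)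
  qed
  ultimately obtain g r where r: "strict_mono r"
    and g: "((\<lambda>n k. inner (x n) (e k)) \<circ> r) \<longlonglongrightarrow> g"
    using seq_compactE[of P "\<lambda>n k. inner (x n) (e k)"] by blast
  have conv_e: "(\<lambda>n. inner (x (r n)) (e k)) \<longlonglongrightarrow> g k" for k
  proof -
    have "continuous_on UNIV (\<lambda>h :: nat \<Rightarrow> real. h k)"
      by (rule continuous_on_product_then_coordinatewise) (simp add: continuous_on_id)
    from continuous_on_tendsto_compose[OF this g] show ?thesis by (simp add: o_def)
  qed
  have "Cauchy (\<lambda>n. inner (x (r n)) w)" for w
  proof (rule CauchyI)
    fix eps :: real assume eps: "0 < eps"
    \<comment> \<open>\<open>C + 1\<close> in place of \<open>C\<close>, which may be zero.\<close>
    define \<delta> where "\<delta> = eps / 3 / (C + 1)"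
    have "\<delta> > 0" using eps C by (simp add: \<delta>_def)
    have C\<delta>: "(C + 1) * \<delta> = eps / 3"
      using C unfolding \<delta>_def
      by (subst times_divide_eq_right, intro nonzero_mult_div_cancel_left) linarith
    have "w \<in> closure D" using D by simp
    with \<open>\<delta> > 0\<close> obtain y where "y \<in> D" "dist y w < \<delta>" unfolding closure_approachable by blast
    then obtain k where k: "norm (w - e k) < \<delta>" using rng by (auto simp: dist_norm norm_minus_commute)
    have close: "\<bar>inner (x n) w - inner (x n) (e k)\<bar> < eps / 3" for n
    proof -
      have "\<bar>inner (x n) w - inner (x n) (e k)\<bar> \<le> norm (x n) * norm (w - e k)"
        using Cauchy_Schwarz_ineq2[of "x n" "w - e k"] by (simp add: inner_diff_right)
      also have "\<dots> \<le> C * \<delta>" using x[of n] k C by (intro mult_mono) auto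
      also have "\<dots> < (C + 1) * \<delta>" using \<open>\<delta> > 0\<close> by (simp add: algebra_simps)
      also have "\<dots> = eps / 3" by (rule C\<delta>)
      finally show ?thesis .
    qed
    have "Cauchy (\<lambda>n. inner (x (r n)) (e k))" using conv_e LIMSEQ_imp_Cauchy by blast
    from CauchyD[OF this, of "eps / 3"] eps obtain M
      where M: "\<And>m n. m \<ge> M \<Longrightarrow> n \<ge> M \<Longrightarrow> \<bar>inner (x (r m)) (e k) - inner (x (r n)) (e k)\<bar> < eps / 3"
      by auto
    have "\<bar>inner (x (r m)) w - inner (x (r n)) w\<bar> < eps" if "m \<ge> M" "n \<ge> M" for m n
      using M[OF that] close[of "r m"] close[of "r n"] by linarith
    then show "\<exists>M. \<forall>m\<ge>M. \<forall>n\<ge>M. norm (inner (x (r m)) w - inner (x (r n)) w) < eps" by auto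
  qed
  then obtain F where F: "\<And>w. (\<lambda>n. inner (x (r n)) w) \<longlonglongrightarrow> F w"
    unfolding Cauchy_convergent_iff convergent_def by metis
  have "bounded_linear F"
  proof (rule bounded_linear_intro[where K = C])
    fix v w and s :: real
    show "F (v + w) = F v + F w"
      using tendsto_add[OF F[of v] F[of w]] F[of "v + w"] LIMSEQ_unique
      by (auto simp: inner_add_right)
    show "F (s *\<^sub>R v) = s *\<^sub>R F v"
      using tendsto_mult_left[OF F[of v], of s] F[of "s *\<^sub>R v"] LIMSEQ_unique by auto
    have "\<bar>inner (x n) v\<bar> \<le> norm v * C" for n
      using Cauchy_Schwarz_ineq2[of "x n" v] mult_right_mono[OF x[of n], of "norm v"]
      by (simp add: mult.commute)
    then show "norm (F v) \<le> norm v * C"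
      by (intro LIMSEQ_le_const2[OF tendsto_norm[OF F]]) auto
  qed
  then obtain l where l: "\<And>w. F w = inner l w" using Riesz_representation by blast
  have "weakly_tendsto (x \<circ> r) l"
    unfolding weakly_tendsto_def
  proof (intro allI impI)
    fix f :: "'a \<Rightarrow> real" assume "bounded_linear f"
    then obtain z where z: "\<And>w. f w = inner z w" using Riesz_representation by blast
    show "(\<lambda>j. f ((x \<circ> r) j)) \<longlonglongrightarrow> f l"
      using F[of z] by (simp add: z l inner_commute)
  qed
  with r show thesis using that by blast
qed

section \<open>Symmetric bilinear forms\<close>

lemmas bilinear_expand = bilinear_ladd bilinear_radd bilinear_lmul bilinear_rmul
  bilinear_lsub bilinear_rsub bilinear_lneg bilinear_rneg

lemma quadratic_form_add_scaleR:
  assumes "symmetric_bilinear_form h"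
  shows "h (u + s *\<^sub>R v) (u + s *\<^sub>R v) = h u u + 2 * s * h u v + s\<^sup>2 * h v v"
proof -
  have bl: "bilinear h" and sym: "h v u = h u v"
    using assms by (auto simp: symmetric_bilinear_form_def)
  show ?thesis
    by (simp add: bilinear_expand[OF bl] sym power2_eq_square algebra_simps)
qed

lemma symmetric_bilinear_form_diff_scaled:
  assumes "symmetric_bilinear_form g" "symmetric_bilinear_form h"
  shows "symmetric_bilinear_form (\<lambda>u v. g u v - c * h u v)"
proof -
  have bl: "bilinear g" "bilinear h" using assms by (auto simp: symmetric_bilinear_form_def)
  have "bilinear (\<lambda>u v. g u v - c * h u v)"
    unfolding bilinear_def
    by (auto intro!: linearI simp: bilinear_expand[OF bl(1)] bilinear_expand[OF bl(2)] algebra_simps)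
  then show ?thesis using assms by (simp add: symmetric_bilinear_form_def)
qed

text \<open>A null vector of a nonnegative form minimizes the quadratic form, so the derivative there, which
  is \<open>2 h(u, \<cdot>)\<close>, vanishes.\<close>

lemma nonneg_form_null_vector:
  assumes h: "symmetric_bilinear_form h" and nonneg: "\<And>v. 0 \<le> h v v" and null: "h u u = 0"
  shows "h u v = 0"
proof (rule linear_coefficient_zero)
  fix s :: real
  show "0 \<le> 2 * s * h u v + s\<^sup>2 * h v v"
    using nonneg[of "u + s *\<^sub>R v"] null by (simp add: quadratic_form_add_scaleR[OF h])
qed

lemma continuous_coercive_nonneg:
  assumes "continuous_coercive a"
  shows "0 \<le> a u u"
  using assms unfolding continuous_coercive_def
  by (meson less_eq_real_def mult_nonneg_nonneg order_trans zero_le_power2)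

text \<open>The hypothesis on \<open>a\<close> bounds only its diagonal. Expanding \<open>a(w + v, w + v)\<close> bounds
  \<open>a(w, v)\<close> for unit vectors \<open>w\<close>, and homogeneity does the rest.\<close>

lemma continuous_coercive_bounded_linear:
  assumes a: "symmetric_bilinear_form a" and cc: "continuous_coercive a"
  shows "bounded_linear (\<lambda>u. a u v)"
proof -
  obtain k K where k: "0 < k" "k \<le> K"
    and up: "\<And>u. a u u \<le> K * (norm u)\<^sup>2"
    using cc unfolding continuous_coercive_def by blast
  have bl: "bilinear a" using a by (simp add: symmetric_bilinear_form_def)
  have pos: "0 \<le> a u u" for u
    by (rule continuous_coercive_nonneg[OF cc])
  define B where "B = K * (1 + norm v)\<^sup>2"
  have one: "a w v \<le> B" if "norm w = 1" for w
  proof -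
    have "a (w + 1 *\<^sub>R v) (w + 1 *\<^sub>R v) \<le> K * (norm (w + v))\<^sup>2" using up[of "w + v"] by simp
    also have "\<dots> \<le> B" unfolding B_def
      using norm_triangle_ineq[of w v] that k by (intro mult_left_mono power_mono) auto
    finally have "2 * a w v \<le> B"
      using pos[rule_format, of w] pos[rule_format, of v] by (simp add: quadratic_form_add_scaleR[OF a, of w 1 v, simplified])
    moreover have "0 \<le> B" using k by (simp add: B_def)
    ultimately show ?thesis by linarith
  qed
  show ?thesis
  proof (rule bounded_linear_intro[where K = B])
    fix x y and s :: real
    show "a (x + y) v = a x v + a y v" "a (s *\<^sub>R x) v = s *\<^sub>R a x v"
      by (simp_all add: bilinear_expand[OF bl])
    show "norm (a x v) \<le> norm x * B"
    proof (cases "x = 0")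
      case True
      then show ?thesis by (simp add: bilinear_lzero[OF bl])
    next
      case False
      define w where "w = (1 / norm x) *\<^sub>R x"
      have "norm w = 1" "x = norm x *\<^sub>R w" using False by (auto simp: w_def)
      moreover have "\<bar>a w v\<bar> \<le> B"
        using one[of w] one[of "- w"] \<open>norm w = 1\<close> by (simp add: bilinear_expand[OF bl] abs_le_iff)
      ultimately show ?thesis
        using mult_left_mono[of "\<bar>a w v\<bar>" B "norm x"]
          bilinear_lmul[OF bl, of "norm x" w v] by (simp add: abs_mult)
    qed
  qed
qed

text \<open>Weak lower semicontinuity of the energy. From \<open>0 \<le> a(x\<^sub>n - v, x\<^sub>n - v)\<close> one gets
  \<open>2 a(x\<^sub>n, v) - a(v, v) \<le> a(x\<^sub>n, x\<^sub>n)\<close>, where the left side is affine in \<open>x\<^sub>n\<close>, so that it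
  converges to \<open>a(v, v)\<close>.\<close>

lemma weak_limit_energy_le:
  assumes a: "symmetric_bilinear_form a" and cc: "continuous_coercive a"
    and x: "weakly_tendsto x v" and le: "\<And>n. a (x n) (x n) \<le> y n" and y: "y \<longlonglongrightarrow> L"
  shows "a v v \<le> L"
proof -
  have "(\<lambda>n. a (x n) v) \<longlonglongrightarrow> a v v"
    by (rule x[unfolded weakly_tendsto_def, rule_format,
          OF continuous_coercive_bounded_linear[OF a cc, of v]])
  then have "(\<lambda>n. 2 * a (x n) v - a v v) \<longlonglongrightarrow> 2 * a v v - a v v" by (intro tendsto_intros)
  moreover have "2 * a (x n) v - a v v \<le> y n" for n
  proof -
    have "0 \<le> a (x n + (- 1) *\<^sub>R v) (x n + (- 1) *\<^sub>R v)"
      by (rule continuous_coercive_nonneg[OF cc])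
    also have "\<dots> = a (x n) (x n) - 2 * a (x n) v + a v v"
      by (simp add: quadratic_form_add_scaleR[OF a] del: scaleR_minus1_left scaleR_minus_left)
    finally show ?thesis using le[of n] by linarith
  qed
  ultimately show ?thesis using LIMSEQ_le[OF _ y] by fastforce
qed

section \<open>Attainment of the least Rayleigh quotient\<close>

text \<open>The compactness argument behind both the finiteness and the attainment of the infimum. The
  vectors violating the bounds \<open>\<gamma> n\<close> are normalized and a weakly convergent subsequence is taken.
  If its limit were zero, then \<open>c\<close> and \<open>m\<close> would tend to zero along it, and since the \<open>\<gamma> n\<close> are
  bounded above, the energies \<open>a\<close> of unit vectors would have limit superior at most zero, against
  coercivity.\<close>

lemma low_energy_seq_nonzero_weak_limit:
  fixes a c m :: "'a::{real_inner, complete_space} \<Rightarrow> 'a \<Rightarrow> real"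
  assumes sep: "separable_space (euclidean :: 'a topology)"
    and a: "symmetric_bilinear_form a" and cc: "continuous_coercive a"
    and c: "bilinear c" "weakly_continuous_form c"
    and m: "bilinear m" "weakly_continuous_form m" "\<forall>u. u \<noteq> 0 \<longrightarrow> m u u > 0"
    and bad: "\<And>n::nat. \<exists>v. a v v - c v v < \<gamma> n * m v v"
    and \<gamma>: "\<And>n. \<gamma> n \<le> \<Gamma>"
  obtains x r v where "strict_mono r" "v \<noteq> 0" "weakly_tendsto x v"
    "\<And>n. a (x n) (x n) \<le> \<gamma> (r n) * m (x n) (x n) + c (x n) (x n)"
    "(\<lambda>n. m (x n) (x n)) \<longlonglongrightarrow> m v v" "(\<lambda>n. c (x n) (x n)) \<longlonglongrightarrow> c v v"
proof -
  have bl: "bilinear a" using a by (simp add: symmetric_bilinear_form_def)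
  have "\<exists>w. norm w = 1 \<and> a w w \<le> \<gamma> n * m w w + c w w" for n
  proof -
    obtain v where v: "a v v - c v v < \<gamma> n * m v v" using bad by blast
    then have nz: "v \<noteq> 0" by (auto simp: bilinear_lzero[OF bl] bilinear_lzero[OF c(1)] bilinear_lzero[OF m(1)])
    define s where "s = 1 / norm v"
    have hom: "h (s *\<^sub>R v) (s *\<^sub>R v) = s\<^sup>2 * h v v" if "bilinear h" for h :: "'a \<Rightarrow> 'a \<Rightarrow> real"
      by (simp add: bilinear_expand[OF that] power2_eq_square)
    have "s\<^sup>2 * a v v \<le> s\<^sup>2 * (\<gamma> n * m v v + c v v)" using v by (intro mult_left_mono) auto
    then have "a (s *\<^sub>R v) (s *\<^sub>R v) \<le> \<gamma> n * m (s *\<^sub>R v) (s *\<^sub>R v) + c (s *\<^sub>R v) (s *\<^sub>R v)"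
      by (simp add: hom[OF bl] hom[OF c(1)] hom[OF m(1)] algebra_simps)
    moreover have "norm (s *\<^sub>R v) = 1" using nz by (simp add: s_def)
    ultimately show ?thesis by blast
  qed
  then obtain w where w: "\<And>n. norm (w n) = 1"
    "\<And>n. a (w n) (w n) \<le> \<gamma> n * m (w n) (w n) + c (w n) (w n)" by metis
  obtain r v where r: "strict_mono r" and v: "weakly_tendsto (w \<circ> r) v"
    using bounded_seq_weakly_convergent_subseq[OF sep, of w 1] w(1) by auto
  define x where "x = w \<circ> r"
  have xw: "weakly_tendsto x v" using v by (simp add: x_def)
  have xle: "a (x n) (x n) \<le> \<gamma> (r n) * m (x n) (x n) + c (x n) (x n)" for n
    using w(2) by (simp add: x_def)
  have lim: "(\<lambda>n. m (x n) (x n)) \<longlonglongrightarrow> m v v" "(\<lambda>n. c (x n) (x n)) \<longlonglongrightarrow> c v v"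
    using m(2) c(2) xw unfolding weakly_continuous_form_def by blast+
  have "v \<noteq> 0"
  proof
    assume "v = 0"
    then have z: "m v v = 0" "c v v = 0" using bilinear_lzero[OF m(1)] bilinear_lzero[OF c(1)] by auto
    obtain k where k: "0 < k" "\<And>u. k * (norm u)\<^sup>2 \<le> a u u"
      using cc unfolding continuous_coercive_def by blast
    have "k \<le> \<Gamma> * m (x n) (x n) + c (x n) (x n)" for n
    proof -
      have "m (x n) (x n) \<ge> 0" using m(3)[rule_format, of "x n"] bilinear_lzero[OF m(1)] by (cases "x n = 0") auto
      then have "\<gamma> (r n) * m (x n) (x n) \<le> \<Gamma> * m (x n) (x n)" using \<gamma> by (intro mult_right_mono)
      then show ?thesis using xle[of n] k(2)[of "x n"] w(1)[of "r n"] by (simp add: x_def)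
    qed
    moreover have "(\<lambda>n. \<Gamma> * m (x n) (x n) + c (x n) (x n)) \<longlonglongrightarrow> \<Gamma> * 0 + 0"
      using lim z by (intro tendsto_intros) auto
    ultimately have "k \<le> 0" using LIMSEQ_le_const by fastforce
    with k show False by simp
  qed
  with r xw xle lim show thesis using that by blast
qed

text \<open>The least quotient is found as the supremum of the set \<open>S\<close> of its lower bounds. If \<open>S\<close> were
  empty, there would be vectors with quotient below \<open>- n\<close> for each \<open>n\<close>, and a subsequence of their
  normalizations would tend weakly to some \<open>v \<noteq> 0\<close>; then \<open>c\<close> would exceed \<open>n m\<close> along them with \<open>m\<close> tending to
  \<open>m(v, v) > 0\<close>, although \<open>c\<close> converges.\<close>

lemma Rayleigh_quotient_minimizer:
  fixes a c m :: "'a::{real_inner, complete_space} \<Rightarrow> 'a \<Rightarrow> real"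
  assumes sep: "separable_space (euclidean :: 'a topology)"
    and a: "symmetric_bilinear_form a" and cc: "continuous_coercive a"
    and c: "bilinear c" "weakly_continuous_form c"
    and m: "bilinear m" "weakly_continuous_form m" "\<forall>u. u \<noteq> 0 \<longrightarrow> m u u > 0"
    and nontriv: "\<exists>z::'a. z \<noteq> 0"
  obtains u \<mu> where "u \<noteq> 0" "a u u - c u u = \<mu> * m u u" "\<And>v. \<mu> * m v v \<le> a v v - c v v"
proof -
  note seq = low_energy_seq_nonzero_weak_limit[OF sep a cc c m]
  define S where "S = {\<mu>. \<forall>v. \<mu> * m v v \<le> a v v - c v v}"
  have "S \<noteq> {}"
  proof
    assume "S = {}"
    then have "- real n \<notin> S" for n by simp
    then have "\<exists>v. a v v - c v v < - real n * m v v" for n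
      unfolding S_def mem_Collect_eq not_all not_le .
    then obtain x r v where r: "strict_mono (r :: nat \<Rightarrow> nat)" and "v \<noteq> 0"
      and le: "\<And>n. a (x n) (x n) \<le> - real (r n) * m (x n) (x n) + c (x n) (x n)"
      and lim: "(\<lambda>n. m (x n) (x n)) \<longlonglongrightarrow> m v v" "(\<lambda>n. c (x n) (x n)) \<longlonglongrightarrow> c v v"
      by (rule seq[of "\<lambda>n. - real n" 0]) auto
    have "0 \<le> a (x n) (x n)" for n
      by (rule continuous_coercive_nonneg[OF cc])
    then have bnd: "m (x n) (x n) * real (r n) \<le> c (x n) (x n)" for n
      using le[of n] by (smt (verit) minus_mult_left mult.commute)
    have "filterlim (\<lambda>n. real (r n)) at_top sequentially"
      using filterlim_subseq[OF r] filterlim_compose filterlim_real_sequentially by blast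
    then have "filterlim (\<lambda>n. m (x n) (x n) * real (r n)) at_top sequentially"
      using filterlim_tendsto_pos_mult_at_top[OF lim(1)] m(3)[rule_format, OF \<open>v \<noteq> 0\<close>] by blast
    then have "filterlim (\<lambda>n. c (x n) (x n)) at_top sequentially"
      by (rule filterlim_at_top_mono) (simp add: bnd)
    then show False using lim(2) not_tendsto_and_filterlim_at_infinity[OF _ lim(2)]
      filterlim_at_top_imp_at_infinity by force
  qed
  have bdd: "bdd_above S"
  proof -
    obtain z :: 'a where "z \<noteq> 0" using nontriv by blast
    then have "\<mu> \<le> (a z z - c z z) / m z z" if "\<mu> \<in> S" for \<mu>
      using that m(3)[rule_format, of z] by (simp add: S_def field_simps)
    then show ?thesis by (rule bdd_aboveI)
  qed
  define \<mu> where "\<mu> = Sup S"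
  have mnn: "0 \<le> m v v" for v using m(3)[rule_format, of v] bilinear_lzero[OF m(1)] by (cases "v = 0") auto
  have low: "\<mu> * m v v \<le> a v v - c v v" for v
  proof (cases "v = 0")
    case True
    obtain \<nu> where "\<nu> \<in> S" using \<open>S \<noteq> {}\<close> by blast
    then have "\<nu> * m v v \<le> a v v - c v v" by (simp add: S_def)
    with True show ?thesis by (simp add: bilinear_lzero[OF m(1)])
  next
    case False
    have "\<mu> \<le> (a v v - c v v) / m v v" unfolding \<mu>_def
    proof (rule cSup_least[OF \<open>S \<noteq> {}\<close>])
      fix \<nu> assume "\<nu> \<in> S"
      then show "\<nu> \<le> (a v v - c v v) / m v v" using m(3)[rule_format, OF False] by (simp add: S_def field_simps)
    qed
    then show ?thesis using m(3)[rule_format, OF False] by (simp add: field_simps)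
  qed
  define \<gamma> where "\<gamma> n = \<mu> + 1 / (real n + 1)" for n :: nat
  have "\<exists>v. a v v - c v v < \<gamma> n * m v v" for n
  proof (rule ccontr)
    assume "\<nexists>v. a v v - c v v < \<gamma> n * m v v"
    then have "\<gamma> n \<in> S" by (auto simp: S_def not_less)
    then have "\<gamma> n \<le> \<mu>" unfolding \<mu>_def by (rule cSup_upper[OF _ bdd])
    then show False by (simp add: \<gamma>_def divide_le_0_iff)
  qed
  then obtain x r v where r: "strict_mono (r :: nat \<Rightarrow> nat)" and "v \<noteq> 0" and x: "weakly_tendsto x v"
      and le: "\<And>n. a (x n) (x n) \<le> \<gamma> (r n) * m (x n) (x n) + c (x n) (x n)"
      and lim: "(\<lambda>n. m (x n) (x n)) \<longlonglongrightarrow> m v v" "(\<lambda>n. c (x n) (x n)) \<longlonglongrightarrow> c v v"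
    by (rule seq[of \<gamma> "\<mu> + 1"]) (auto simp: \<gamma>_def)
  have "\<gamma> \<longlonglongrightarrow> \<mu>" unfolding \<gamma>_def by real_asymp
  then have "(\<lambda>n. \<gamma> (r n)) \<longlonglongrightarrow> \<mu>" using LIMSEQ_subseq_LIMSEQ[OF _ r] by (simp add: o_def)
  then have "(\<lambda>n. \<gamma> (r n) * m (x n) (x n) + c (x n) (x n)) \<longlonglongrightarrow> \<mu> * m v v + c v v"
    by (intro tendsto_intros lim)
  then have "a v v \<le> \<mu> * m v v + c v v" using weak_limit_energy_le[OF a cc x le] by blast
  with low[of v] have "a v v - c v v = \<mu> * m v v" by linarith
  with \<open>v \<noteq> 0\<close> low show thesis using that by blast
qed

section \<open>The first eigencurve\<close>

text \<open>The variational characterisation of the least eigenvalue. A nonzero vector is required because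
  otherwise every \<open>\<nu>\<close> satisfies the right side, while the left side still bounds \<open>\<nu>\<close>.\<close>

lemma le_first_eigencurve_iff:
  fixes a b m :: "'a::{real_inner, complete_space} \<Rightarrow> 'a \<Rightarrow> real"
  assumes sep: "separable_space (euclidean :: 'a topology)"
    and a: "symmetric_bilinear_form a" and b: "symmetric_bilinear_form b"
    and m: "symmetric_bilinear_form m" and cc: "continuous_coercive a"
    and wb: "weakly_continuous_form b" and wm: "weakly_continuous_form m"
    and pos: "\<forall>u. u \<noteq> 0 \<longrightarrow> m u u > 0" and nontriv: "\<exists>z::'a. z \<noteq> 0"
  shows "\<nu> \<le> first_eigencurve a b m t \<longleftrightarrow> (\<forall>v. \<nu> * m v v \<le> a v v - t * b v v)"
proof -
  have bl: "bilinear b" "bilinear m" using b m by (auto simp: symmetric_bilinear_form_def)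
  have tb: "bilinear (\<lambda>u v. t * b u v)"
    unfolding bilinear_def by (auto intro!: linearI simp: bilinear_expand[OF bl(1)] algebra_simps)
  have wtb: "weakly_continuous_form (\<lambda>u v. t * b u v)"
    using wb by (auto simp: weakly_continuous_form_def intro!: tendsto_mult_left)
  obtain u \<mu> where "u \<noteq> 0" and eq: "a u u - t * b u u = \<mu> * m u u"
    and low: "\<And>v. \<mu> * m v v \<le> a v v - t * b v v"
    using Rayleigh_quotient_minimizer[OF sep a cc tb wtb bl(2) wm pos nontriv] by blast
  have sym: "symmetric_bilinear_form (\<lambda>u v. (a u v - t * b u v) - \<mu> * m u v)"
    by (intro symmetric_bilinear_form_diff_scaled a b m)
  have "(a u v - t * b u v) - \<mu> * m u v = 0" for v
    by (rule nonneg_form_null_vector[OF sym]) (use eq low in auto)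
  then have "is_eigenvalue a b m t \<mu>"
    unfolding is_eigenvalue_def using \<open>u \<noteq> 0\<close> by (metis eq_iff_diff_eq_0)
  moreover have "\<mu> \<le> \<nu>" if "is_eigenvalue a b m t \<nu>" for \<nu>
  proof -
    obtain w where "w \<noteq> 0" "a w w - t * b w w = \<nu> * m w w"
      using \<open>is_eigenvalue a b m t \<nu>\<close> unfolding is_eigenvalue_def by blast
    then show ?thesis using low[of w] pos[rule_format, of w] by simp
  qed
  ultimately have "first_eigencurve a b m t = \<mu>"
    unfolding first_eigencurve_def by (rule Least_equality)
  moreover have "\<nu> \<le> \<mu> \<longleftrightarrow> (\<forall>v. \<nu> * m v v \<le> a v v - t * b v v)"
  proof
    assume "\<nu> \<le> \<mu>"
    show "\<forall>v. \<nu> * m v v \<le> a v v - t * b v v"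
    proof
      fix v
      have "0 \<le> m v v" using pos[rule_format, of v] bilinear_lzero[OF bl(2)] by (cases "v = 0") auto
      with \<open>\<nu> \<le> \<mu>\<close> have "\<nu> * m v v \<le> \<mu> * m v v" by (rule mult_right_mono)
      with low[of v] show "\<nu> * m v v \<le> a v v - t * b v v" by linarith
    qed
  next
    assume "\<forall>v. \<nu> * m v v \<le> a v v - t * b v v"
    then have "\<nu> * m u u \<le> \<mu> * m u u" using eq by metis
    then show "\<nu> \<le> \<mu>" using pos[rule_format, OF \<open>u \<noteq> 0\<close>] by simp
  qed
  ultimately show ?thesis by simp
qed

theorem lemma4p3:
  fixes a b m :: "'a::{real_inner, complete_space} \<Rightarrow> 'a \<Rightarrow> real"
  assumes "separable_space (euclidean :: 'a topology)"
    and "symmetric_bilinear_form a" and "symmetric_bilinear_form b" and "symmetric_bilinear_form m"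
    and "continuous_coercive a"
    and "weakly_continuous_form b"
    and "weakly_continuous_form m" and "\<And>u. u \<noteq> 0 \<Longrightarrow> m u u > 0"
  shows "concave_on UNIV (first_eigencurve a b m)"
proof (cases "\<exists>z::'a. z \<noteq> 0")
  case True
  let ?\<mu> = "first_eigencurve a b m"
  have pos: "\<forall>u. u \<noteq> 0 \<longrightarrow> m u u > 0" using assms(8) by blast
  note le_iff = le_first_eigencurve_iff[OF assms(1-7) pos True]
  have low: "?\<mu> t * m v v \<le> a v v - t * b v v" for t v
    using le_iff[of "?\<mu> t" t] by blast
  show ?thesis
    unfolding concave_on_iff
  proof (intro conjI ballI allI impI convex_UNIV)
    fix s t p q :: real
    assume p: "0 \<le> p" and q: "0 \<le> q" and pq: "p + q = 1"
    show "p * ?\<mu> s + q * ?\<mu> t \<le> ?\<mu> (p *\<^sub>R s + q *\<^sub>R t)"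
    proof (rule iffD2[OF le_iff], rule allI)
      fix v
      have "(p * ?\<mu> s + q * ?\<mu> t) * m v v = p * (?\<mu> s * m v v) + q * (?\<mu> t * m v v)"
        by (simp add: algebra_simps)
      also have "\<dots> \<le> p * (a v v - s * b v v) + q * (a v v - t * b v v)"
        by (intro add_mono mult_left_mono low p q)
      also have "\<dots> = (p + q) * a v v - (p *\<^sub>R s + q *\<^sub>R t) * b v v" by (simp add: algebra_simps)
      finally show "(p * ?\<mu> s + q * ?\<mu> t) * m v v \<le> a v v - (p *\<^sub>R s + q *\<^sub>R t) * b v v"
        by (simp add: pq)
    qed
  qed
next
  case False
  \<comment> \<open>The zero space has no eigenvalues, so the curve is constant.\<close>
  then have "first_eigencurve a b m = (\<lambda>t. LEAST \<mu>. False)"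
    by (simp add: first_eigencurve_def is_eigenvalue_def fun_eq_iff)
  then show ?thesis by (simp add: concave_on_const)
qed

end
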